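(* Let $\Lambda\subseteq\mathbb{R}^d$ be a finite union of cut-and-project sets in $\mathbb{R}^d$, where $d>1$. Then $\Lambda$ is not a Danzer set.
   Context: A set $Y\subseteq\mathbb{R}^d$ is a Danzer set if it intersects every convex subset of $\mathbb{R}^d$ of volume $1$. A grid in $\mathbb{R}^n$ is a translate of a lattice in $\mathbb{R}^n$. Let $d>1$, $k\ge 1$, $n=d+k$ be integers, write $\mathbb{R}^n=\mathbb{R}^d\oplus\mathbb{R}^k$, and let $\pi_{phys}:\mathbb{R}^n\to\mathbb{R}^d$, $\pi_{phys}(x_1,\dots,x_n)=(x_1,\dots,x_d)$ and $\pi_{int}:\mathbb{R}^n\to\mathbb{R}^k$, $\pi_{int}(x_1,\dots,x_n)=(x_{d+1},\dots,x_n)$. For a grid $L\subseteq\mathbb{R}^n$ and a bounded subset $W\subseteq\mathbb{R}^k$, the set $\Lambda(L,W)=\pi_{phys}\left(L\cap\pi_{int}^{-1}(W)\right)\subseteq\mathbb{R}^d$ is called a cut-and-project set. In a union of cut-and-project sets in $\mathbb{R}^d$, the internal dimension $k$, the grid $L$ and the window $W$ may differ from one set to another. *)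

theory Defs
  imports "HOL-Analysis.Analysis" "HOL-Library.Function_Algebras"
begin

definition danzer :: "(real ^ 'd) set \<Rightarrow> bool" where
  "danzer Y \<longleftrightarrow> (\<forall>K. convex K \<and> emeasure lebesgue K = 1 \<longrightarrow> K \<inter> Y \<noteq> {})"

(* The internal dimension k varies from one cut-and-project set to another, so it cannot be
   carried by a type. R^k is the subspace of the vector space of real sequences consisting of
   those supported on {..<k}, and R^n = R^d (+) R^k is the subspace UNIV \<times> Rint k of
   (real ^ 'd) \<times> (nat \<Rightarrow> real). *)

instantiation "fun" :: (type, real_vector) real_vector
begin

definition scaleR_fun :: "real \<Rightarrow> ('a \<Rightarrow> 'b) \<Rightarrow> 'a \<Rightarrow> 'b" where
  "scaleR_fun r f = (\<lambda>x. r *\<^sub>R f x)"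

instance
  by standard (simp_all add: scaleR_fun_def fun_eq_iff scaleR_add_right scaleR_add_left)

end

definition Rint :: "nat \<Rightarrow> (nat \<Rightarrow> real) set" where
  "Rint k = {y. \<forall>i\<ge>k. y i = 0}"

definition lattice_in :: "'v::real_vector set \<Rightarrow> 'v set \<Rightarrow> bool" where
  "lattice_in V L \<longleftrightarrow> (\<exists>B. finite B \<and> independent B \<and> span B = V \<and>
     L = {(\<Sum>b\<in>B. of_int (c b) *\<^sub>R b) |c :: 'v \<Rightarrow> int. True})"

definition grid_in :: "'v::real_vector set \<Rightarrow> 'v set \<Rightarrow> bool" where
  "grid_in V G \<longleftrightarrow> (\<exists>L. \<exists>v\<in>V. lattice_in V L \<and> G = (\<lambda>x. v + x) ` L)"

(* Boundedness for the Euclidean norm of R^k. The library's bounded at type nat \<Rightarrow> real refers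
   to a metric for the product topology in which every set of sequences is bounded. *)
definition bounded_window :: "nat \<Rightarrow> (nat \<Rightarrow> real) set \<Rightarrow> bool" where
  "bounded_window k W \<longleftrightarrow> W \<subseteq> Rint k \<and> (\<exists>M. \<forall>y\<in>W. L2_set y {..<k} \<le> M)"

abbreviation pi_phys :: "(real ^ 'd) \<times> (nat \<Rightarrow> real) \<Rightarrow> real ^ 'd" where
  "pi_phys \<equiv> fst"

abbreviation pi_int :: "(real ^ 'd) \<times> (nat \<Rightarrow> real) \<Rightarrow> nat \<Rightarrow> real" where
  "pi_int \<equiv> snd"

definition cut_and_project ::
  "((real ^ 'd) \<times> (nat \<Rightarrow> real)) set \<Rightarrow> (nat \<Rightarrow> real) set \<Rightarrow> (real ^ 'd) set" where
  "cut_and_project L W = pi_phys ` (L \<inter> pi_int -` W)"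

definition cut_and_project_set :: "(real ^ 'd) set \<Rightarrow> bool" where
  "cut_and_project_set S \<longleftrightarrow> (\<exists>k\<ge>1. \<exists>L W. grid_in (UNIV \<times> Rint k) L \<and> bounded_window k W \<and>
     S = cut_and_project L W)"

end

(* A vector (w, y) of the dual lattice with y small forces the numbers w \<bullet> x, for x in the
   cut-and-project set, to lie near a fixed translate of the integers. For each of the finitely many
   sets one looks for such a vector, with w nonzero, and for one volume-preserving linear map h that
   makes all the vectors h w short. If h' is the adjoint of h and Q the unit cube, then w \<bullet> x is almost
   constant on x0 + h' Q, and for a suitable x0 it stays away from all the translates of the integers,
   so that this convex set of volume 1 is missed.
   A pigeonhole argument on volumes shows that, for every volume-preserving g, each dual lattice has
   a vector (w, y) with y small and with g w bounded independently of g. Since h can then be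
   bounded independently of g, the vectors are shortened one after the other. *)

theory Submission
  imports Defs
begin

subsection \<open>Volume-preserving linear maps\<close>

text \<open>For a linear map this amounts to determinant \<open>1\<close> or \<open>-1\<close>. It
  is phrased through measures because only volumes of images enter the argument.\<close>

definition volume_preserving :: "(real^'d \<Rightarrow> real^'d) \<Rightarrow> bool" where
  "volume_preserving f \<longleftrightarrow>
     (\<forall>S\<in>lmeasurable. f ` S \<in> lmeasurable \<and> measure lebesgue (f ` S) = measure lebesgue S)"

text \<open>\<open>g\<close> acts on the dual vectors, while its adjoint \<open>g'\<close> acts on
  the physical space, where the convex set is built. Both are carried along so that composites need
  no separate construction of the adjoint.\<close>

definition unimodular_pair :: "(real^'d \<Rightarrow> real^'d) \<Rightarrow> (real^'d \<Rightarrow> real^'d) \<Rightarrow> bool" where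
  "unimodular_pair g g' \<longleftrightarrow> linear g \<and> linear g' \<and> (\<forall>x y. g x \<bullet> y = x \<bullet> g' y) \<and>
     volume_preserving g \<and> volume_preserving g'"

lemma volume_preserving_id: "volume_preserving (\<lambda>x. x)"
  by (simp add: volume_preserving_def)

lemma volume_preserving_compose:
  assumes "volume_preserving f" "volume_preserving g"
  shows "volume_preserving (\<lambda>x. f (g x))"
proof -
  have "(\<lambda>x. f (g x)) ` S = f ` g ` S" for S by (simp only: image_image)
  then show ?thesis using assms by (simp add: volume_preserving_def)
qed

lemma unimodular_pair_id: "unimodular_pair (\<lambda>x. x) (\<lambda>x. x)"
  by (simp add: unimodular_pair_def volume_preserving_id linear_ident)

lemma unimodular_pair_compose:
  assumes "unimodular_pair g g'" "unimodular_pair h h'"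
  shows "unimodular_pair (\<lambda>x. h (g x)) (\<lambda>y. g' (h' y))"
  using assms linear_compose[of g h] linear_compose[of h' g']
    volume_preserving_compose[of h g] volume_preserving_compose[of g' h']
  by (simp add: unimodular_pair_def o_def)

lemma volume_preserving_unit_shear:
  fixes m n :: "'d::finite"
  assumes "m \<noteq> n"
  shows "volume_preserving (\<lambda>x::real^'d. \<chi> i. if i = m then x$m + x$n else x$i)"
    (is "volume_preserving ?f")
proof -
  have lin: "linear ?f"
    by (rule linearI) (auto simp: vec_eq_iff algebra_simps)
  have box: "measure lebesgue (?f ` cbox a b) = 1 * measure lebesgue (cbox a b)" for a b
  proof (cases "cbox a b = {}")
    case False
    \<comment> \<open>\<open>measure_shear_interval\<close> wants a box whose lower corner has
      nonnegative \<open>n\<close>-th coordinate. Translation by \<open>v\<close> makes that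
      coordinate \<open>0\<close>.\<close>
    define v :: "real^'d" where "v = axis n (- a$n)"
    have ne: "cbox (v + a) (v + b) \<noteq> {}"
      using False by (simp add: cbox_translation)
    have "?f ` cbox (v + a) (v + b) = (+) (?f v) ` ?f ` cbox a b"
      by (simp add: cbox_translation image_image linear_add[OF lin])
    then have "measure lebesgue (?f ` cbox a b) = measure lebesgue (?f ` cbox (v + a) (v + b))"
      by (simp add: measure_translation)
    also have "\<dots> = measure lebesgue (cbox (v + a) (v + b))"
      by (rule measure_shear_interval[OF assms ne]) (simp add: v_def)
    also have "\<dots> = measure lebesgue (cbox a b)"
      unfolding cbox_translation by (rule measure_translation)
    finally show ?thesis by simp
  qed simp
  show ?thesis
    unfolding volume_preserving_def
  proof (intro ballI)
    fix S :: "(real^'d) set" assume "S \<in> lmeasurable"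
    from measure_linear_sufficient[OF lin this box]
    show "?f ` S \<in> lmeasurable \<and> measure lebesgue (?f ` S) = measure lebesgue S"
      by (simp only: mult_1)
  qed
qed

lemma volume_preserving_stretch:
  fixes c :: "'d::finite \<Rightarrow> real"
  assumes "\<bar>prod c UNIV\<bar> = 1"
  shows "volume_preserving (\<lambda>x::real^'d. \<chi> i. c i * x$i)"
  using assms by (auto simp: volume_preserving_def measurable_stretch measure_stretch)

text \<open>For \<open>c\<close> nonzero, the shear is the unit shear conjugated by the stretch of
  coordinate \<open>n\<close> by \<open>c\<close>; the volume factors of the two stretches
  cancel.\<close>

lemma volume_preserving_shear:
  fixes m n :: "'d::finite"
  assumes "m \<noteq> n"
  shows "volume_preserving (\<lambda>x::real^'d. \<chi> i. if i = m then x$m + c * x$n else x$i)"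
proof (cases "c = 0")
  case True
  have "(\<lambda>x::real^'d. \<chi> i. if i = m then x$m + c * x$n else x$i) = (\<lambda>x. x)"
    using True by (auto simp: vec_eq_iff)
  then show ?thesis by (simp add: volume_preserving_id)
next
  case False
  let ?D = "\<lambda>c. \<lambda>x::real^'d. \<chi> i. (if i = n then c else 1) * x$i"
  let ?f = "\<lambda>x::real^'d. \<chi> i. if i = m then x$m + x$n else x$i"
  have [simp]: "(\<Prod>i\<in>UNIV. if i = n then a else 1) = (a::real)" for a
    by simp
  have conj: "(\<lambda>x::real^'d. \<chi> i. if i = m then x$m + c * x$n else x$i)
      = (\<lambda>x. ?D (1/c) (?f (?D c x)))"
    using False assms by (auto simp: vec_eq_iff)
  show ?thesis
    unfolding volume_preserving_def
  proof (intro ballI)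
    fix S :: "(real^'d) set" assume S: "S \<in> lmeasurable"
    have 1: "?D c ` S \<in> lmeasurable" "measure lebesgue (?D c ` S) = \<bar>c\<bar> * measure lebesgue S"
      using measurable_stretch[OF S] measure_stretch[OF S, of "\<lambda>i. if i = n then c else 1"] by auto
    have 2: "?f ` ?D c ` S \<in> lmeasurable"
      "measure lebesgue (?f ` ?D c ` S) = measure lebesgue (?D c ` S)"
      using volume_preserving_unit_shear[OF assms] 1(1) by (auto simp: volume_preserving_def)
    have 3: "?D (1/c) ` ?f ` ?D c ` S \<in> lmeasurable"
      "measure lebesgue (?D (1/c) ` ?f ` ?D c ` S) = \<bar>1/c\<bar> * measure lebesgue (?f ` ?D c ` S)"
      using measurable_stretch[OF 2(1)]
        measure_stretch[OF 2(1), of "\<lambda>i. if i = n then 1/c else 1"] by auto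
    have eq: "(\<lambda>x::real^'d. \<chi> i. if i = m then x$m + c * x$n else x$i) ` S
        = ?D (1/c) ` ?f ` ?D c ` S"
      unfolding conj by (simp only: image_image)
    show "(\<lambda>x. \<chi> i. if i = m then x$m + c * x$n else x$i) ` S \<in> lmeasurable \<and>
        measure lebesgue ((\<lambda>x. \<chi> i. if i = m then x$m + c * x$n else x$i) ` S)
          = measure lebesgue S"
      unfolding eq using 1 2 3 False by simp
  qed
qed

lemma unimodular_pair_shear:
  fixes m n :: "'d::finite"
  assumes "m \<noteq> n"
  shows "unimodular_pair (\<lambda>x::real^'d. \<chi> i. if i = m then x$m + c * x$n else x$i)
           (\<lambda>x. \<chi> i. if i = n then x$n + c * x$m else x$i)"
proof -
  define s where "s = (\<lambda>m n. \<lambda>x::real^'d. \<chi> i. if i = m then x$m + c * x$n else x$i)"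
  \<comment> \<open>As a rank-one perturbation of the identity, the shear visibly has the shear with
    \<open>m\<close> and \<open>n\<close> exchanged as its adjoint.\<close>
  have eq: "s m n x = x + (c * x$n) *\<^sub>R axis m 1" for m n x
    by (simp add: s_def vec_eq_iff axis_def)
  have "linear (s m n)" for m n
    by (rule linearI) (simp_all add: s_def vec_eq_iff algebra_simps)
  moreover have "s m n x \<bullet> y = x \<bullet> s n m y" for x y
    by (simp add: eq inner_add_left inner_add_right inner_axis inner_axis')
  moreover have "volume_preserving (s m n)" "volume_preserving (s n m)"
    unfolding s_def using assms by (simp_all add: volume_preserving_shear)
  ultimately have "unimodular_pair (s m n) (s n m)"
    by (simp add: unimodular_pair_def)
  then show ?thesis by (simp add: s_def)
qed

text \<open>A composition of one elementary shear per index of \<open>Q\<close>. They do not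
  interfere, because each of them leaves coordinate \<open>p\<close> unchanged. The adjoint is left
  existential, as no formula for it is needed.\<close>

lemma unimodular_pair_multi_shear:
  fixes p :: "'d::finite" and c :: "'d \<Rightarrow> real"
  assumes "finite Q" "p \<notin> Q"
  shows "\<exists>h'. unimodular_pair (\<lambda>x::real^'d. \<chi> i. if i \<in> Q then x$i - c i * x$p else x$i) h'"
  using assms
proof (induction Q)
  case empty
  have "(\<lambda>x::real^'d. \<chi> i. if i \<in> {} then x$i - c i * x$p else x$i) = (\<lambda>x. x)"
    by (auto simp: vec_eq_iff)
  then show ?case using unimodular_pair_id by metis
next
  case (insert q Q)
  let ?h = "\<lambda>Q. \<lambda>x::real^'d. \<chi> i. if i \<in> Q then x$i - c i * x$p else x$i"
  obtain h' where h': "unimodular_pair (?h Q) h'"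
    using insert by auto
  have "q \<noteq> p" using insert by auto
  note unimodular_pair_compose[OF h' unimodular_pair_shear[OF this, of "- c q"]]
  moreover have "(\<lambda>x::real^'d. \<chi> i. if i = q then ?h Q x$q + - c q * ?h Q x$p else ?h Q x$i)
      = ?h (insert q Q)"
    using insert by (auto simp: vec_eq_iff fun_eq_iff)
  ultimately show ?case by auto
qed

text \<open>The second coordinate \<open>q\<close> compensates for the contraction along
  \<open>p\<close>, so that the determinant is \<open>1\<close>; a diagonal map is its own
  adjoint.\<close>

lemma unimodular_pair_squeeze:
  fixes p q :: "'d::finite"
  assumes "p \<noteq> q" "\<delta> \<noteq> 0"
  defines "D \<equiv> \<lambda>x::real^'d. \<chi> i. (if i = p then \<delta> else if i = q then 1/\<delta> else 1) * x$i"
  shows "unimodular_pair D D"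
proof -
  have "(\<Prod>i\<in>UNIV. if i = p then \<delta> else if i = q then 1/\<delta> else 1)
      = (\<Prod>i\<in>{p,q}. if i = p then \<delta> else if i = q then 1/\<delta> else 1)"
    by (rule prod.mono_neutral_right) auto
  also have "\<dots> = 1" using assms by simp
  finally have "volume_preserving D"
    unfolding D_def by (intro volume_preserving_stretch) simp
  moreover have "linear D"
    unfolding D_def by (rule linearI) (auto simp: vec_eq_iff algebra_simps)
  moreover have "D x \<bullet> y = x \<bullet> D y" for x y
    by (auto simp: D_def inner_vec_def intro: sum.cong)
  ultimately show ?thesis by (auto simp: unimodular_pair_def)
qed

section \<open>Shortening vectors by volume-preserving maps of bounded norm\<close>

lemma norm_le_CARD_bound:
  fixes x :: "real^'d" and b :: real
  assumes "\<And>i. \<bar>x$i\<bar> \<le> b"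
  shows "norm x \<le> CARD('d) * b"
proof -
  have "norm x \<le> (\<Sum>i\<in>UNIV. \<bar>x$i\<bar>)" by (rule norm_le_l1_cart)
  also have "\<dots> \<le> (\<Sum>i\<in>(UNIV::'d set). b)" by (rule sum_mono) (rule assms)
  finally show ?thesis by simp
qed

text \<open>Shears with coefficients at most 1 turn the vector into a multiple of the axis of its largest
  entry, and a squeeze along that axis makes it short. It is essential below that the bound on the
  norm of the map does not depend on the vector.\<close>

lemma unimodular_pair_shrink:
  assumes "CARD('d::finite) > 1" "\<epsilon> > 0"
  shows "\<exists>R>0. \<forall>w::real^'d. norm w \<le> A \<longrightarrow>
    (\<exists>h h'. unimodular_pair h h' \<and> norm (h w) \<le> \<epsilon> \<and> (\<forall>x. norm (h x) \<le> R * norm x))"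
proof (cases "A > 0")
  case False
  have "\<exists>h h'. unimodular_pair h h' \<and> norm (h w) \<le> \<epsilon> \<and> (\<forall>x. norm (h x) \<le> 1 * norm x)"
    if "norm w \<le> A" for w :: "real^'d"
    using that False assms(2) unimodular_pair_id by (intro exI[of _ "\<lambda>x. x"]) auto
  then show ?thesis by (intro exI[of _ 1]) auto
next
  case True
  define n where "n = real CARD('d)"
  have n1: "n > 1" using assms by (simp add: n_def)
  \<comment> \<open>The squeeze factor: small enough to bring length \<open>A\<close> below
    \<epsilon> despite the factor \<open>n\<close> of the coordinatewise norm estimate, and at most
    \<open>1\<close> so that the squeeze has entries at most \<open>1/\<delta>\<close>.\<close>
  define \<delta> where "\<delta> = min 1 (\<epsilon> / (n * A))"
  have \<delta>: "0 < \<delta>" "\<delta> \<le> 1" "n * (\<delta> * A) \<le> \<epsilon>"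
  proof -
    show "0 < \<delta>" "\<delta> \<le> 1" using True n1 assms(2) by (auto simp: \<delta>_def)
    have "\<delta> \<le> \<epsilon> / (n * A)" by (simp add: \<delta>_def)
    then show "n * (\<delta> * A) \<le> \<epsilon>" using True n1 by (simp add: field_simps)
  qed
  \<comment> \<open>The product of the coordinatewise norm bounds \<open>n/\<delta>\<close> for the
    squeeze \<open>D\<close> and \<open>2 * n\<close> for the shear \<open>S\<close>; it involves
    \<open>A\<close> and \<epsilon> but not \<open>w\<close>.\<close>
  define R where "R = n * (1/\<delta> * (n * 2))"
  have R: "R > 0" "R \<ge> 1"
  proof -
    show "R > 0" using n1 \<delta> by (simp add: R_def)
    have "1 * (1 * (1 * 1)) \<le> n * (1/\<delta> * (n * 2))"
      using n1 \<delta> by (intro mult_mono) auto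
    then show "R \<ge> 1" by (simp add: R_def)
  qed
  have "\<exists>h h'. unimodular_pair h h' \<and> norm (h w) \<le> \<epsilon> \<and> (\<forall>x. norm (h x) \<le> R * norm x)"
    if w: "norm w \<le> A" for w :: "real^'d"
  proof (cases "w = 0")
    case True
    have "norm x \<le> R * norm x" for x :: "real^'d"
      using mult_right_mono[OF R(2), of "norm x"] by simp
    then show ?thesis
      using True assms(2) unimodular_pair_id by (intro exI[of _ "\<lambda>x. x"]) auto
  next
    case False
    have "Max (range (\<lambda>i. \<bar>w$i\<bar>)) \<in> range (\<lambda>i. \<bar>w$i\<bar>)" by (intro Max_in) auto
    then obtain p where p0: "\<bar>w$p\<bar> = Max (range (\<lambda>i. \<bar>w$i\<bar>))"
      unfolding image_iff by metis
    have p: "\<bar>w$i\<bar> \<le> \<bar>w$p\<bar>" for i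
      unfolding p0 by (intro Max_ge) auto
    have wp: "w$p \<noteq> 0"
    proof
      assume "w$p = 0"
      then have "w$i = 0" for i using p[of i] by simp
      then show False using False by (simp add: vec_eq_iff)
    qed
    \<comment> \<open>Here dimension greater than \<open>1\<close> enters: it supplies the
      coordinate \<open>q\<close> that absorbs the stretch.\<close>
    have "(UNIV :: 'd set) \<noteq> {p}"
    proof
      assume "(UNIV :: 'd set) = {p}"
      then have "CARD('d) = card {p}" by (rule arg_cong)
      with assms(1) show False by simp
    qed
    then obtain q where q: "q \<noteq> p" by blast
    define c where "c = (\<lambda>i. w$i / w$p)"
    have c: "\<bar>c i\<bar> \<le> 1" for i
      using p[of i] wp by (simp add: c_def)
    define S where "S = (\<lambda>x::real^'d. \<chi> i. if i \<in> - {p} then x$i - c i * x$p else x$i)"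
    obtain S' where S': "unimodular_pair S S'"
      unfolding S_def using unimodular_pair_multi_shear[of "- {p}" p c] by auto
    define D where "D = (\<lambda>x::real^'d. \<chi> i. (if i = p then \<delta> else if i = q then 1/\<delta> else 1) * x$i)"
    have D': "unimodular_pair D D"
      unfolding D_def using \<delta> q by (intro unimodular_pair_squeeze) auto
    have S_le: "norm (S x) \<le> n * (2 * norm x)" for x
      unfolding n_def
    proof (rule norm_le_CARD_bound)
      fix i
      have "\<bar>c i * x$p\<bar> \<le> 1 * norm x"
        unfolding abs_mult by (intro mult_mono c component_le_norm_cart) auto
      then show "\<bar>S x $ i\<bar> \<le> 2 * norm x"
        using component_le_norm_cart[of x i] by (auto simp: S_def)
    qed
    have D_le: "norm (D x) \<le> n * (1/\<delta> * norm x)" for x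
      unfolding n_def
    proof (rule norm_le_CARD_bound)
      fix i
      have "1 \<le> 1/\<delta>" "\<delta> \<le> 1/\<delta>" using \<delta> by (auto simp: field_simps mult_le_one)
      then have "\<bar>if i = p then \<delta> else if i = q then 1/\<delta> else 1\<bar> \<le> 1/\<delta>"
        using \<delta> by auto
      then show "\<bar>D x $ i\<bar> \<le> 1/\<delta> * norm x"
        unfolding D_def vec_lambda_beta abs_mult
        using \<delta> by (intro mult_mono component_le_norm_cart) auto
    qed
    have "norm (D (S x)) \<le> R * norm x" for x
    proof -
      have "norm (D (S x)) \<le> n * (1/\<delta> * norm (S x))" by (rule D_le)
      also have "\<dots> \<le> n * (1/\<delta> * (n * (2 * norm x)))"
        using S_le[of x] n1 \<delta> by (intro mult_left_mono) auto
      finally show ?thesis by (simp add: R_def mult_ac)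
    qed
    \<comment> \<open>\<open>S w\<close> vanishes outside coordinate \<open>p\<close>, so
      \<open>D\<close> just multiplies it by \<delta>.\<close>
    moreover have "norm (D (S w)) \<le> \<epsilon>"
    proof -
      have "norm (D (S w)) \<le> n * (\<delta> * A)"
        unfolding n_def
      proof (rule norm_le_CARD_bound)
        fix i
        have "\<bar>w$p\<bar> \<le> A" using component_le_norm_cart[of w p] w by simp
        then show "\<bar>D (S w) $ i\<bar> \<le> \<delta> * A"
          using wp \<delta> True by (auto simp: D_def S_def c_def abs_mult)
      qed
      with \<delta> show ?thesis by simp
    qed
    ultimately show ?thesis
      using unimodular_pair_compose[OF S' D'] by blast
  qed
  then show ?thesis using R by blast
qed

text \<open>\<open>A\<close> has to be uniform in \<open>g\<close>: the vectors are chosen one after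
  the other, each after the maps already applied, and its length must be controlled in
  advance.\<close>

definition short_vectors :: "(real^'d) set \<Rightarrow> bool" where
  "short_vectors G \<longleftrightarrow> (\<exists>A. \<forall>g g'. unimodular_pair g g' \<longrightarrow> (\<exists>w\<in>G. norm (g w) \<le> A))"

text \<open>Induction on the family: first make the new vector so short that the map provided by the
  induction hypothesis, whose norm is bounded in advance, cannot spoil it.\<close>

lemma simultaneous_short_vectors:
  fixes G :: "'i \<Rightarrow> (real^'d) set"
  assumes "CARD('d) > 1" "finite I" "\<And>i. i \<in> I \<Longrightarrow> short_vectors (G i)" "\<epsilon> > 0"
  shows "\<exists>R>0. \<forall>g g'. unimodular_pair g g' \<longrightarrow>
    (\<exists>h h'. unimodular_pair h h' \<and> (\<forall>x. norm (h x) \<le> R * norm x) \<and>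
      (\<forall>i\<in>I. \<exists>w\<in>G i. norm (h (g w)) \<le> \<epsilon>))"
  using assms(2,3)
proof (induction I)
  case empty
  show ?case
    using unimodular_pair_id
    by (intro exI[of _ 1]) (auto intro!: exI[of _ "\<lambda>x. x"])
next
  case (insert j I)
  obtain R' where R': "R' > 0" and IH: "\<And>g g'. unimodular_pair g g' \<Longrightarrow>
    (\<exists>h h'. unimodular_pair h h' \<and> (\<forall>x. norm (h x) \<le> R' * norm x) \<and>
      (\<forall>i\<in>I. \<exists>w\<in>G i. norm (h (g w)) \<le> \<epsilon>))"
    using insert.IH[OF insert.prems[OF insertI2]] by blast
  obtain A where A: "\<And>g g'. unimodular_pair g g' \<Longrightarrow> \<exists>w\<in>G j. norm (g w) \<le> A"
    using insert.prems[of j] unfolding short_vectors_def by blast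
  obtain R1 where R1: "R1 > 0" "\<And>w::real^'d. norm w \<le> A \<Longrightarrow>
    \<exists>h h'. unimodular_pair h h' \<and> norm (h w) \<le> \<epsilon> / R' \<and> (\<forall>x. norm (h x) \<le> R1 * norm x)"
    using unimodular_pair_shrink[OF assms(1), of "\<epsilon> / R'" A] R' assms(4) by auto
  have "\<exists>h h'. unimodular_pair h h' \<and> (\<forall>x. norm (h x) \<le> R' * R1 * norm x) \<and>
      (\<forall>i\<in>insert j I. \<exists>w\<in>G i. norm (h (g w)) \<le> \<epsilon>)" if g: "unimodular_pair g g'" for g g'
  proof -
    obtain w where w: "w \<in> G j" "norm (g w) \<le> A" using A[OF g] by auto
    obtain k k' where k: "unimodular_pair k k'" "norm (k (g w)) \<le> \<epsilon> / R'"
      "\<And>x. norm (k x) \<le> R1 * norm x"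
      using R1(2)[OF w(2)] by auto
    \<comment> \<open>The induction hypothesis is used for the composite of \<open>g\<close> and
      \<open>k\<close>; this is why the statement allows an arbitrary \<open>g\<close>.\<close>
    obtain h h' where h: "unimodular_pair h h'" "\<And>x. norm (h x) \<le> R' * norm x"
      "\<And>i. i \<in> I \<Longrightarrow> \<exists>w\<in>G i. norm (h (k (g w))) \<le> \<epsilon>"
      using IH[OF unimodular_pair_compose[OF g k(1)]] by auto
    have "norm (h (k (g w))) \<le> \<epsilon>"
      using h(2)[of "k (g w)"] mult_left_mono[OF k(2), of R'] R' by simp
    moreover have "norm (h (k x)) \<le> R' * R1 * norm x" for x
      using order_trans[OF h(2)[of "k x"] mult_left_mono[OF k(3)[of x], of R']] R'
      by (simp add: mult.assoc)
    ultimately show ?thesis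
      using unimodular_pair_compose[OF k(1) h(1)] w(1) h(3)
      by (intro exI[of _ "\<lambda>x. h (k x)"] exI[of _ "\<lambda>y. k' (h' y)"]) auto
  qed
  moreover have "R' * R1 > 0" using R' R1 by simp
  ultimately show ?case by blast
qed

subsection \<open>Short vectors in dual lattices\<close>

text \<open>A singular linear map would send the unit ball to a null set.\<close>

lemma unimodular_pair_bij:
  assumes "unimodular_pair g g'"
  shows "inj g" "surj g"
proof -
  have lin: "linear g" and vol: "volume_preserving g"
    using assms by (auto simp: unimodular_pair_def)
  show inj: "inj g"
  proof (rule ccontr)
    assume "\<not> inj g"
    then have "negligible (g ` ball 0 1)"
      by (rule negligible_linear_singular_image[OF lin])
    then have "measure lebesgue (g ` ball 0 1) = 0"
      by (rule negligible_imp_measure0)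
    moreover have "measure lebesgue (g ` ball 0 1) = measure lebesgue (ball (0 :: real^'a) 1)"
      using vol by (simp add: volume_preserving_def)
    ultimately show False
      using content_ball_pos[of 1 "0 :: real^'a"] by (simp add: measure_completion)
  qed
  show "surj g" by (rule linear_injective_imp_surjective[OF lin inj refl])
qed

text \<open>Volume counting: if the points of each class were far apart after applying the map, their
  disjoint balls would not fit into the image of a large ball. This replaces Minkowski's theorem,
  which would need Lebesgue measure in dimension \<open>d + k\<close> with \<open>k\<close> not given by a type.\<close>

lemma uniformly_close_pair:
  fixes Y :: "(real^'d) set" and f :: "real^'d \<Rightarrow> 'c"
  assumes dense: "\<And>x. \<exists>y\<in>Y. dist y x < R" and "finite (f ` Y)"
  shows "\<exists>A. \<forall>g g'. unimodular_pair g g' \<longrightarrow>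
    (\<exists>y\<in>Y. \<exists>z\<in>Y. y \<noteq> z \<and> f y = f z \<and> norm (g (y - z)) \<le> A)"
proof (intro exI allI impI)
  define d where "d = CARD('d)"
  define m where "m = card (f ` Y)"
  define V where "V = measure lebesgue (ball (0 :: real^'d) 1)"
  have V: "V > 0" unfolding V_def using content_ball_pos[of 1 "0 :: real^'d"] by (simp add: measure_completion)
  have ball: "measure lebesgue (ball c r) = r ^ d * V" if "r \<ge> 0" for c :: "real^'d" and r
    using content_ball_conv_unit_ball[OF that, of c] by (simp add: d_def V_def measure_completion)
  then have content: "measure lborel (ball c r) = r ^ d * V" if "r \<ge> 0" for c :: "real^'d" and r
    using that by (simp add: measure_completion)
  obtain y0 where "y0 \<in> Y" "dist y0 0 < R" using dense by blast
  then have R: "R > 0" using zero_le_dist[of y0 0] by linarith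
  \<comment> \<open>Chosen so that \<open>A/2\<close> is \<open>2 * R\<close> times
    \<open>m + 1\<close>: since the dimension \<open>d\<close> is at least \<open>1\<close>,
    \<open>(A/2) ^ d\<close> then exceeds \<open>m * (2 * R) ^ d\<close>, against the final
    count.\<close>
  define A where "A = 4 * R * (real m + 1)"
  have A: "A > 0" using R by (simp add: A_def add_nonneg_pos)
  fix g g' :: "real^'d \<Rightarrow> real^'d"
  assume g: "unimodular_pair g g'"
  then have lin: "linear g" and vol: "volume_preserving g"
    by (auto simp: unimodular_pair_def)
  show "\<exists>y\<in>Y. \<exists>z\<in>Y. y \<noteq> z \<and> f y = f z \<and> norm (g (y - z)) \<le> A"
  proof (rule ccontr)
    assume "\<not> ?thesis"
    then have sep: "norm (g (y - z)) > A" if "y \<in> Y" "z \<in> Y" "y \<noteq> z" "f y = f z" for y z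
      using that by force
    obtain b where b: "b > 0" "\<And>x. b * norm x \<le> norm (g x)"
      using linear_inj_bounded_below_pos[OF lin unimodular_pair_bij(1)[OF g]] by blast
    \<comment> \<open>A ball of radius \<open>A/2\<close> pulls back under \<open>g\<close> into one
      of radius \<open>A / (2 * b)\<close>. Around a centre of norm below \<open>N + R\<close> it
      stays inside radius \<open>N + R + A / (2 * b) = 2 * N\<close>.\<close>
    define N where "N = R + A / (2 * b)"
    have N: "N > 0" using R A b by (simp add: N_def add_pos_pos)
    have "cball (0 :: real^'d) N \<subseteq> (\<Union>y\<in>Y. ball y R)"
      using dense by (force simp: ball_def)
    then obtain P0 where P0: "P0 \<subseteq> Y" "finite P0" "cball 0 N \<subseteq> (\<Union>y\<in>P0. ball y R)"
      using compactE_image[OF compact_cball[of 0 N], of Y "\<lambda>y. ball y R"] by auto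
    \<comment> \<open>Centres further out cannot help to cover \<open>ball 0 N\<close>, and would
      spoil the containment in radius \<open>2 * N\<close>.\<close>
    define P where "P = {y\<in>P0. norm y < N + R}"
    have P: "P \<subseteq> Y" "finite P" using P0 by (auto simp: P_def)
    have cover: "ball 0 N \<subseteq> (\<Union>y\<in>P. ball y R)"
    proof
      fix x :: "real^'d" assume "x \<in> ball 0 N"
      then have x: "norm x < N" by simp
      then obtain y where y: "y \<in> P0" "dist y x < R" using P0(3) by force
      have "norm y \<le> norm x + norm (y - x)" by (rule norm_triangle_sub)
      then have "norm y < N + R" using x y by (simp add: dist_norm)
      then show "x \<in> (\<Union>y\<in>P. ball y R)" using y by (auto simp: P_def)
    qed
    have "N ^ d * V \<le> measure lebesgue (\<Union>y\<in>P. ball y R)"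
      unfolding ball[OF less_imp_le[OF N], of 0, symmetric]
      using cover P(2) by (intro measure_mono_fmeasurable) (auto intro!: fmeasurable.finite_UN)
    also have "\<dots> \<le> (\<Sum>y\<in>P. measure lebesgue (ball y R))"
      using P(2) by (intro measure_UNION_le) auto
    also have "\<dots> = card P * (R ^ d * V)"
      using R by (simp add: content)
    finally have count: "N ^ d \<le> card P * R ^ d"
      using V by (simp add: mult.assoc[symmetric])
    have cell: "card {y\<in>P. f y = c} * (A/2) ^ d \<le> (2 * N) ^ d" for c
    proof -
      let ?Q = "{y\<in>P. f y = c}"
      have "card ?Q * ((A/2) ^ d * V) = (\<Sum>y\<in>?Q. measure lebesgue (ball (g y) (A/2)))"
        using A by (simp add: content)
      also have "\<dots> = measure lebesgue (\<Union>y\<in>?Q. ball (g y) (A/2))"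
      proof (rule measure_UNION'[symmetric])
        show "pairwise (\<lambda>y z. disjnt (ball (g y) (A/2)) (ball (g z) (A/2))) ?Q"
        proof (rule pairwiseI)
          fix y z assume yz: "y \<in> ?Q" "z \<in> ?Q" "y \<noteq> z"
          then have "A < norm (g (y - z))" using P(1) by (intro sep) auto
          then have "A < dist (g y) (g z)" by (simp add: linear_diff[OF lin] dist_norm)
          then show "disjnt (ball (g y) (A/2)) (ball (g z) (A/2))"
            unfolding disjnt_def by (intro disjoint_ballI) simp
        qed
      qed (use P in auto)
      also have "\<dots> \<le> measure lebesgue (g ` ball 0 (2 * N))"
      proof (rule measure_mono_fmeasurable)
        show "(\<Union>y\<in>?Q. ball (g y) (A/2)) \<subseteq> g ` ball 0 (2 * N)"
        proof clarify
          fix y x assume y: "y \<in> P" and x: "x \<in> ball (g y) (A/2)"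
          obtain u where u: "x = g u" using unimodular_pair_bij(2)[OF g] by blast
          have "b * norm (u - y) < A/2"
            using b(2)[of "u - y"] x by (simp add: u linear_diff[OF lin] dist_norm norm_minus_commute)
          then have "norm (u - y) < A / (2 * b)" using b(1) by (simp add: field_simps)
          moreover have "norm u \<le> norm y + norm (u - y)" by (rule norm_triangle_sub)
          ultimately have "norm u < 2 * N" using y by (simp add: P_def N_def)
          then show "x \<in> g ` ball 0 (2 * N)" by (auto simp: u)
        qed
      qed (use P vol in \<open>auto simp: volume_preserving_def\<close>)
      also have "\<dots> = (2 * N) ^ d * V"
        using vol N by (simp add: volume_preserving_def content)
      finally show ?thesis using V by (simp add: mult.assoc[symmetric])
    qed
    have "card P = (\<Sum>c\<in>f ` Y. card {y\<in>P. f y = c})"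
    proof -
      have "card P = card (\<Union>c\<in>f ` Y. {y\<in>P. f y = c})"
        using P(1) by (intro arg_cong[of _ _ card]) auto
      also have "\<dots> = (\<Sum>c\<in>f ` Y. card {y\<in>P. f y = c})"
        using assms(2) P(2) by (intro card_UN_disjoint) auto
      finally show ?thesis .
    qed
    then have "card P * (A/2) ^ d = (\<Sum>c\<in>f ` Y. card {y\<in>P. f y = c} * (A/2) ^ d)"
      by (simp add: sum_distrib_right)
    also have "\<dots> \<le> (\<Sum>c\<in>f ` Y. (2 * N) ^ d)"
      by (intro sum_mono cell)
    finally have total: "card P * (A/2) ^ d \<le> m * (2 * N) ^ d"
      by (simp add: m_def)
    have "N ^ d * (A/2) ^ d \<le> card P * R ^ d * (A/2) ^ d"
      using count A by (intro mult_right_mono) auto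
    also have "\<dots> \<le> m * (2 * N) ^ d * R ^ d"
      using mult_right_mono[OF total, of "R ^ d"] R by (simp add: mult_ac)
    \<comment> \<open>\<open>N\<close> depends on \<open>g\<close> through \<open>b\<close>, but it
      cancels; this makes a choice of \<open>A\<close> independent of \<open>g\<close>
      possible.\<close>
    finally have "N ^ d * (A/2) ^ d \<le> N ^ d * (m * (2 * R) ^ d)"
      by (simp add: power_mult_distrib mult_ac)
    then have "(A/2) ^ d \<le> m * (2 * R) ^ d"
      using N by simp
    moreover have "A/2 = (2 * R) * (real m + 1)" by (simp add: A_def)
    ultimately have "(2 * R) ^ d * (real m + 1) ^ d \<le> (2 * R) ^ d * m"
      by (metis mult.commute power_mult_distrib)
    then have "(real m + 1) ^ d \<le> m" using R by simp
    moreover have "(real m + 1) ^ 1 \<le> (real m + 1) ^ d"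
      by (rule power_increasing) (auto simp: d_def Suc_le_eq)
    ultimately show False by simp
  qed
qed

section \<open>The dual lattice and its points near physical space\<close>

lemma sum_fun_apply: "(\<Sum>i\<in>I. f i) x = (\<Sum>i\<in>I. f i x)"
  for f :: "'i \<Rightarrow> 'a \<Rightarrow> 'b::comm_monoid_add"
  by (induction I rule: infinite_finite_induct) auto

definition pairing :: "nat \<Rightarrow> (real^'d) \<times> (nat \<Rightarrow> real) \<Rightarrow> (real^'d) \<times> (nat \<Rightarrow> real) \<Rightarrow> real" where
  "pairing k \<phi> p = fst \<phi> \<bullet> fst p + (\<Sum>j<k. snd \<phi> j * snd p j)"

text \<open>Entries of \<open>snd \<phi>\<close> from \<open>k\<close> on are unconstrained, because
  \<open>pairing k\<close> does not see them. Modulo these entries this is the usual dual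
  lattice.\<close>

definition dual_lattice ::
    "nat \<Rightarrow> ((real^'d) \<times> (nat \<Rightarrow> real)) set \<Rightarrow> ((real^'d) \<times> (nat \<Rightarrow> real)) set" where
  "dual_lattice k L = {\<phi>. \<forall>p\<in>L. pairing k \<phi> p \<in> \<int>}"

lemma pairing_diff_left: "pairing k (\<phi> - \<psi>) p = pairing k \<phi> p - pairing k \<psi> p"
  by (simp add: pairing_def inner_diff_left sum_subtractf left_diff_distrib)

lemma pairing_add_right: "pairing k \<phi> (p + q) = pairing k \<phi> p + pairing k \<phi> q"
  by (simp add: pairing_def inner_add_right sum.distrib distrib_left)

lemma dual_lattice_diff:
  assumes "\<phi> \<in> dual_lattice k L" "\<psi> \<in> dual_lattice k L"
  shows "\<phi> - \<psi> \<in> dual_lattice k L"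
  using assms by (simp add: dual_lattice_def pairing_diff_left)

text \<open>A functional is represented by its values on the unit vectors,
  \<open>indicator {j}\<close> being the \<open>j\<close>-th unit sequence. This turns a functional
  prescribed on a lattice basis into a dual vector.\<close>

lemma linear_eq_pairing:
  fixes f :: "(real^'d) \<times> (nat \<Rightarrow> real) \<Rightarrow> real"
  assumes f: "linear f" and p: "p \<in> UNIV \<times> Rint k"
  shows "f p = pairing k (\<chi> i. f (axis i 1, 0), \<lambda>j. f (0, indicator {j})) p"
proof -
  obtain x y where xy: "p = (x, y)" and y: "y \<in> Rint k" using p by auto
  have x_eq: "x = (\<Sum>i\<in>UNIV. x$i *\<^sub>R axis i 1)"
    by (simp add: vec_eq_iff axis_def if_distrib cong: if_cong)
  have y_eq: "y = (\<Sum>j<k. y j *\<^sub>R indicator {j})"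
  proof
    fix t
    have "(\<Sum>j<k. y j *\<^sub>R indicator {j}) t = (\<Sum>j<k. if j = t then y j else 0)"
      unfolding sum_fun_apply by (intro sum.cong) (auto simp: scaleR_fun_def indicator_def)
    then show "y t = (\<Sum>j<k. y j *\<^sub>R indicator {j}) t"
      using y by (auto simp: Rint_def)
  qed
  have lin1: "linear (\<lambda>x. f (x, 0))" and lin2: "linear (\<lambda>y. f (0, y))"
  proof -
    show "linear (\<lambda>x. f (x, 0))"
      using linear_add[OF f, of "(_, 0)" "(_, 0)"] linear_scale[OF f, of _ "(_, 0)"]
      by (intro linearI) simp_all
    show "linear (\<lambda>y. f (0, y))"
      using linear_add[OF f, of "(0, _)" "(0, _)"] linear_scale[OF f, of _ "(0, _)"]
      by (intro linearI) simp_all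
  qed
  have "f p = f (x, 0) + f (0, y)"
    by (simp add: xy flip: linear_add[OF f])
  also have "f (x, 0) = (\<Sum>i\<in>UNIV. x$i * f (axis i 1, 0))"
    by (subst x_eq) (simp add: linear_sum[OF lin1] linear_scale[OF lin1])
  also have "f (0, y) = (\<Sum>j<k. y j * f (0, indicator {j}))"
    by (subst y_eq) (simp add: linear_sum[OF lin2] linear_scale[OF lin2])
  finally show ?thesis
    by (simp add: xy pairing_def inner_vec_def mult.commute zero_fun_def)
qed

text \<open>Round the values, on a basis of the lattice, of the functional given by a physical vector.\<close>

lemma dual_lattice_near:
  fixes L :: "((real^'d) \<times> (nat \<Rightarrow> real)) set"
  assumes "lattice_in (UNIV \<times> Rint k) L"
  shows "\<exists>R \<rho>. \<forall>x. \<exists>\<phi>\<in>dual_lattice k L. norm (fst \<phi> - x) \<le> R \<and> (\<forall>j<k. \<bar>snd \<phi> j\<bar> \<le> \<rho>)"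
proof -
  obtain B where B: "finite B" "independent B" "span B = UNIV \<times> Rint k"
    "L = {(\<Sum>b\<in>B. of_int (c b) *\<^sub>R b) | c. True}"
    using assms unfolding lattice_in_def by blast
  \<comment> \<open>The sum of the absolute coordinates of \<open>p\<close> in the basis
    \<open>B\<close>: it bounds at \<open>p\<close> any linear functional that is at most
    \<open>1\<close> in absolute value on \<open>B\<close>.\<close>
  define H where "H = (\<lambda>p. \<Sum>b\<in>B. \<bar>representation B p b\<bar>)"
  define R where "R = (\<Sum>i\<in>UNIV. H (axis i 1, 0))"
  define \<rho> where "\<rho> = (\<Sum>j<k. H (0, indicator {j}))"
  have H0: "H p \<ge> 0" for p by (simp add: H_def sum_nonneg)
  have "\<exists>\<phi>\<in>dual_lattice k L. norm (fst \<phi> - x) \<le> R \<and> (\<forall>j<k. \<bar>snd \<phi> j\<bar> \<le> \<rho>)" for x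
  proof -
    obtain f :: "(real^'d) \<times> (nat \<Rightarrow> real) \<Rightarrow> real"
      where f: "linear f" "\<And>b. b \<in> B \<Longrightarrow> f b = of_int \<lfloor>x \<bullet> fst b\<rfloor>"
      using linear_independent_extend[OF B(2), of "\<lambda>b. of_int \<lfloor>x \<bullet> fst b\<rfloor>"] by blast
    \<comment> \<open>The rounding error. Its values on the physical unit vectors are the entries of
      \<open>fst \<phi> - x\<close>, and on the internal ones those of
      \<open>snd \<phi>\<close>.\<close>
    define e where "e = (\<lambda>p. f p - x \<bullet> fst p)"
    have lin_e: "linear e"
      using f(1) unfolding e_def
      by (intro linearI)
        (simp_all add: linear_add linear_scale inner_add_right right_diff_distrib)
    have e_b: "\<bar>e b\<bar> \<le> 1" if "b \<in> B" for b
      using f(2)[OF that] unfolding e_def by linarith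
    have e_p: "\<bar>e p\<bar> \<le> H p" if "p \<in> UNIV \<times> Rint k" for p
    proof -
      have "e p = e (\<Sum>b\<in>B. representation B p b *\<^sub>R b)"
        using sum_representation_eq[OF B(2) _ B(1)] that B(3) by auto
      also have "\<dots> = (\<Sum>b\<in>B. representation B p b * e b)"
        by (simp add: linear_sum[OF lin_e] linear_scale[OF lin_e])
      also have "\<bar>\<dots>\<bar> \<le> (\<Sum>b\<in>B. \<bar>representation B p b * e b\<bar>)" by (rule sum_abs)
      also have "\<dots> \<le> H p"
        unfolding H_def abs_mult using e_b by (intro sum_mono mult_left_le) auto
      finally show ?thesis .
    qed
    define \<phi> where "\<phi> = ((\<chi> i. f (axis i 1, 0)) :: real^'d, \<lambda>j. f (0, indicator {j}))"
    have "\<phi> \<in> dual_lattice k L"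
      unfolding dual_lattice_def
    proof (intro CollectI ballI)
      fix p assume "p \<in> L"
      then obtain c :: "(real^'d) \<times> (nat \<Rightarrow> real) \<Rightarrow> int" where c: "p = (\<Sum>b\<in>B. of_int (c b) *\<^sub>R b)"
        using B(4) by blast
      have "p \<in> span B" unfolding c by (intro span_sum span_scale span_base)
      then have "pairing k \<phi> p = f p"
        unfolding \<phi>_def B(3) by (rule linear_eq_pairing[OF f(1), symmetric])
      also have "\<dots> = (\<Sum>b\<in>B. of_int (c b) * f b)"
        by (simp add: c linear_sum[OF f(1)] linear_scale[OF f(1)])
      also have "\<dots> \<in> \<int>" by (intro Ints_sum Ints_mult) (auto simp: f(2))
      finally show "pairing k \<phi> p \<in> \<int>" .
    qed
    moreover have "norm (fst \<phi> - x) \<le> R"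
    proof -
      have "norm (fst \<phi> - x) \<le> (\<Sum>i\<in>UNIV. \<bar>(fst \<phi> - x) $ i\<bar>)" by (rule norm_le_l1_cart)
      also have "\<dots> \<le> R"
        unfolding R_def
      proof (rule sum_mono)
        fix i
        have "(fst \<phi> - x) $ i = e (axis i 1, 0)"
          by (simp add: \<phi>_def e_def inner_axis)
        then show "\<bar>(fst \<phi> - x) $ i\<bar> \<le> H (axis i 1, 0)"
          using e_p[of "(axis i 1, 0)"] by (simp add: Rint_def)
      qed
      finally show ?thesis .
    qed
    moreover have "\<bar>snd \<phi> j\<bar> \<le> \<rho>" if "j < k" for j
    proof -
      have "snd \<phi> j = e (0, indicator {j})" by (simp add: \<phi>_def e_def)
      also have "\<bar>\<dots>\<bar> \<le> H (0, indicator {j})"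
        using that by (intro e_p) (auto simp: Rint_def)
      also have "\<dots> \<le> \<rho>"
        unfolding \<rho>_def using that H0 by (intro member_le_sum) auto
      finally show ?thesis .
    qed
    ultimately show ?thesis by blast
  qed
  then show ?thesis by blast
qed

text \<open>The classes are cubes of side \<open>\<epsilon>\<close> in the internal space. Pairing up points with distinct physical
  parts makes the physical part of the difference nonzero even if the dual lattice meets the
  internal space.\<close>

lemma dual_lattice_short_vectors:
  fixes L :: "((real^'d) \<times> (nat \<Rightarrow> real)) set"
  assumes "lattice_in (UNIV \<times> Rint k) L" "\<epsilon> > 0"
  shows "short_vectors {w. w \<noteq> 0 \<and> (\<exists>y. (\<forall>j<k. \<bar>y j\<bar> \<le> \<epsilon>) \<and> (w, y) \<in> dual_lattice k L)}"
proof -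
  obtain R \<rho> where R: "\<And>x. \<exists>\<phi>\<in>dual_lattice k L. norm (fst \<phi> - x) \<le> R \<and> (\<forall>j<k. \<bar>snd \<phi> j\<bar> \<le> \<rho>)"
    using dual_lattice_near[OF assms(1)] by blast
  define Y where "Y = {w. \<exists>y. (w, y) \<in> dual_lattice k L \<and> (\<forall>j<k. \<bar>y j\<bar> \<le> \<rho>)}"
  \<comment> \<open>Several dual vectors may share a physical part; \<open>s\<close> fixes one
    internal part for each.\<close>
  obtain s where s: "\<And>w. w \<in> Y \<Longrightarrow> (w, s w) \<in> dual_lattice k L \<and> (\<forall>j<k. \<bar>s w j\<bar> \<le> \<rho>)"
    using bchoice[of Y "\<lambda>w y. (w, y) \<in> dual_lattice k L \<and> (\<forall>j<k. \<bar>y j\<bar> \<le> \<rho>)"]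
    unfolding Y_def by auto
  \<comment> \<open>\<open>restrict\<close> gives all classes the same default value from
    \<open>k\<close> on, so that only finitely many functions occur.\<close>
  define f where "f = (\<lambda>w. restrict (\<lambda>j. \<lfloor>s w j / \<epsilon>\<rfloor>) {..<k})"
  \<comment> \<open>The \<open>+ 1\<close> turns the weak bound into the strict one required for
    open balls.\<close>
  have dense: "\<exists>y\<in>Y. dist y x < R + 1" for x
  proof -
    obtain w y where "(w, y) \<in> dual_lattice k L" "norm (w - x) \<le> R" "\<forall>j<k. \<bar>y j\<bar> \<le> \<rho>"
      using R[of x] by fastforce
    then show ?thesis unfolding Y_def by (intro bexI[of _ w]) (auto simp: dist_norm)
  qed
  have "f ` Y \<subseteq> {..<k} \<rightarrow>\<^sub>E {\<lfloor>(- \<rho>) / \<epsilon>\<rfloor>..\<lfloor>\<rho> / \<epsilon>\<rfloor>}"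
  proof clarify
    fix w assume "w \<in> Y"
    then have "(- \<rho>) / \<epsilon> \<le> s w j / \<epsilon>" "s w j / \<epsilon> \<le> \<rho> / \<epsilon>" if "j < k" for j
      using s[of w] that assms(2) by (auto simp: abs_le_iff minus_le_iff intro!: divide_right_mono
          simp del: minus_divide_left divide_minus_left)
    then show "f w \<in> {..<k} \<rightarrow>\<^sub>E {\<lfloor>(- \<rho>) / \<epsilon>\<rfloor>..\<lfloor>\<rho> / \<epsilon>\<rfloor>}"
      unfolding f_def by (auto intro!: floor_mono)
  qed
  then have fin: "finite (f ` Y)"
    by (rule finite_subset) (intro finite_PiE, auto)
  obtain A where A: "\<And>g g'. unimodular_pair g g' \<Longrightarrow>
      \<exists>y\<in>Y. \<exists>z\<in>Y. y \<noteq> z \<and> f y = f z \<and> norm (g (y - z)) \<le> A"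
    using uniformly_close_pair[OF dense fin] by blast
  show ?thesis
    unfolding short_vectors_def
  proof (intro exI allI impI)
    fix g g' :: "real^'d \<Rightarrow> real^'d" assume "unimodular_pair g g'"
    then obtain y z where yz: "y \<in> Y" "z \<in> Y" "y \<noteq> z" "f y = f z" "norm (g (y - z)) \<le> A"
      using A by blast
    have "(y - z, s y - s z) \<in> dual_lattice k L"
      using dual_lattice_diff[of "(y, s y)" k L "(z, s z)"] s yz(1,2) by simp
    moreover have "\<bar>(s y - s z) j\<bar> \<le> \<epsilon>" if "j < k" for j
    proof -
      have "\<lfloor>s y j / \<epsilon>\<rfloor> = \<lfloor>s z j / \<epsilon>\<rfloor>"
        using fun_cong[OF yz(4), of j] that by (simp add: f_def)
      then have "\<bar>s y j / \<epsilon> - s z j / \<epsilon>\<bar> \<le> 1" by linarith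
      then have "\<bar>s y j - s z j\<bar> / \<epsilon> \<le> 1"
        using assms(2) by (simp add: abs_divide flip: diff_divide_distrib)
      then show ?thesis using assms(2) by simp
    qed
    ultimately show "\<exists>w\<in>{w. w \<noteq> 0 \<and> (\<exists>y. (\<forall>j<k. \<bar>y j\<bar> \<le> \<epsilon>) \<and> (w, y) \<in> dual_lattice k L)}.
        norm (g w) \<le> A"
      using yz(3,5) by (intro bexI[of _ "y - z"] CollectI conjI exI[of _ "s y - s z"]) auto
  qed
qed

subsection \<open>Avoiding the integers\<close>

text \<open>For each \<open>i\<close> the bad \<open>s\<close> form intervals of length
  \<open>2 * \<eta> / \<bar>\<alpha> i\<bar>\<close> with spacing
  \<open>1 / \<bar>\<alpha> i\<bar>\<close>, hence of density at most \<open>2 * \<eta>\<close>. All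
  together have density at most \<open>1/4\<close>, so a long interval is not covered.\<close>

lemma exists_multiple_far_from_integers:
  fixes \<alpha> c :: "'i \<Rightarrow> real" and \<eta> :: real
  assumes "finite I" "\<And>i. i \<in> I \<Longrightarrow> \<alpha> i \<noteq> 0" "\<eta> > 0" "8 * card I * \<eta> \<le> 1"
  shows "\<exists>s. \<forall>i\<in>I. \<forall>n::int. \<eta> < \<bar>\<alpha> i * s - c i - of_int n\<bar>"
proof (rule ccontr)
  assume contra: "\<not> ?thesis"
  \<comment> \<open>The boundary terms of the count, independent of the length \<open>S\<close>.
    Covering would give \<open>S \<le> S / 4 + T\<close>, impossible for
    \<open>S = 2 * T + 1\<close>.\<close>
  define T where "T = (\<Sum>i\<in>I. 2 * \<eta> * (2 * \<eta> + 1) / \<bar>\<alpha> i\<bar>)"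
  have T: "T \<ge> 0" unfolding T_def using assms(3) by (intro sum_nonneg) auto
  define S where "S = 2 * T + 1"
  have S: "S > 0" using T by (simp add: S_def)
  \<comment> \<open>\<open>lo i\<close> and \<open>hi i\<close> enclose every integer that can come
    within \<eta> of \<open>\<alpha> i * s - c i\<close> for \<open>s\<close> in
    \<open>{0..S}\<close>.\<close>
  define lo where "lo = (\<lambda>i. min 0 (\<alpha> i * S) - c i - \<eta>)"
  define hi where "hi = (\<lambda>i. max 0 (\<alpha> i * S) - c i + \<eta>)"
  define J where "J = (\<lambda>i n::int. {(c i + of_int n) / \<alpha> i - \<eta> / \<bar>\<alpha> i\<bar>..(c i + of_int n) / \<alpha> i + \<eta> / \<bar>\<alpha> i\<bar>})"
  define U where "U = (\<lambda>i. \<Union>n\<in>{\<lceil>lo i\<rceil>..\<lfloor>hi i\<rfloor>}. J i n)"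
  have U_meas: "U i \<in> lmeasurable" for i
    unfolding U_def J_def by (intro fmeasurable.finite_UN) auto
  have sub: "{0..S} \<subseteq> (\<Union>i\<in>I. U i)"
  proof
    fix s assume s: "s \<in> {0..S}"
    obtain i n where i: "i \<in> I" and n: "\<bar>\<alpha> i * s - c i - of_int n\<bar> \<le> \<eta>"
      using contra by (metis not_less)
    have \<alpha>: "\<alpha> i \<noteq> 0" using assms(2) i by blast
    have "min 0 (\<alpha> i * S) \<le> \<alpha> i * s" "\<alpha> i * s \<le> max 0 (\<alpha> i * S)"
      using s by (cases "\<alpha> i \<ge> 0"; auto simp: mult_left_mono mult_left_mono_neg min_le_iff_disj le_max_iff_disj
          mult_nonneg_nonneg mult_nonpos_nonneg)+
    then have "lo i \<le> of_int n" "of_int n \<le> hi i"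
      using n unfolding lo_def hi_def by linarith+
    then have "n \<in> {\<lceil>lo i\<rceil>..\<lfloor>hi i\<rfloor>}" by (simp add: ceiling_le_iff le_floor_iff)
    moreover have "s \<in> J i n"
    proof -
      have "\<bar>s - (c i + of_int n) / \<alpha> i\<bar> = \<bar>\<alpha> i * s - c i - of_int n\<bar> / \<bar>\<alpha> i\<bar>"
        using \<alpha> by (simp add: field_simps flip: abs_divide)
      also have "\<dots> \<le> \<eta> / \<bar>\<alpha> i\<bar>" using n by (intro divide_right_mono) auto
      finally show ?thesis unfolding J_def by auto
    qed
    ultimately show "s \<in> (\<Union>i\<in>I. U i)" using i unfolding U_def by blast
  qed
  have U_le: "measure lebesgue (U i) \<le> 2 * \<eta> * S + 2 * \<eta> * (2 * \<eta> + 1) / \<bar>\<alpha> i\<bar>" if "i \<in> I" for i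
  proof -
    have \<alpha>: "\<alpha> i \<noteq> 0" using assms(2) that by blast
    have J: "measure lebesgue (J i n) = 2 * \<eta> / \<bar>\<alpha> i\<bar>" for n
      using assms(3) by (simp add: J_def)
    have "measure lebesgue (U i) \<le> (\<Sum>n\<in>{\<lceil>lo i\<rceil>..\<lfloor>hi i\<rfloor>}. measure lebesgue (J i n))"
      unfolding U_def by (rule measure_UNION_le) (auto simp: J_def)
    also have "\<dots> = card {\<lceil>lo i\<rceil>..\<lfloor>hi i\<rfloor>} * (2 * \<eta> / \<bar>\<alpha> i\<bar>)"
      by (simp add: J)
    also have "\<dots> \<le> (\<bar>\<alpha> i\<bar> * S + 2 * \<eta> + 1) * (2 * \<eta> / \<bar>\<alpha> i\<bar>)"
    proof (rule mult_right_mono)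
      have "hi i - lo i = \<bar>\<alpha> i\<bar> * S + 2 * \<eta>"
        using S by (simp add: hi_def lo_def max_def min_def abs_if zero_le_mult_iff mult_le_0_iff)
      moreover have "0 \<le> \<bar>\<alpha> i\<bar> * S" using S by simp
      ultimately show "real (card {\<lceil>lo i\<rceil>..\<lfloor>hi i\<rfloor>}) \<le> \<bar>\<alpha> i\<bar> * S + 2 * \<eta> + 1"
        using assms(3) by simp linarith
    qed (use assms(3) in auto)
    also have "\<dots> = 2 * \<eta> * S + 2 * \<eta> * (2 * \<eta> + 1) / \<bar>\<alpha> i\<bar>"
      using \<alpha> by (simp add: field_simps)
    finally show ?thesis .
  qed
  have "S = measure lebesgue {0..S}" using S by simp
  also have "\<dots> \<le> measure lebesgue (\<Union>i\<in>I. U i)"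
    using sub assms(1) U_meas by (intro measure_mono_fmeasurable) (auto intro!: fmeasurable.finite_UN)
  also have "\<dots> \<le> (\<Sum>i\<in>I. measure lebesgue (U i))"
    using assms(1) U_meas by (intro measure_UNION_le) auto
  also have "\<dots> \<le> (\<Sum>i\<in>I. 2 * \<eta> * S + 2 * \<eta> * (2 * \<eta> + 1) / \<bar>\<alpha> i\<bar>)"
    by (rule sum_mono) (rule U_le)
  also have "\<dots> = (8 * card I * \<eta>) * (S / 4) + T"
    by (simp add: sum.distrib T_def)
  also have "\<dots> \<le> 1 * (S / 4) + T"
    using assms(4) S by (intro add_mono mult_right_mono) auto
  finally show False using T by (simp add: S_def)
qed

text \<open>Finitely many hyperplanes form a null set.\<close>

lemma exists_vector_not_orthogonal:
  fixes w :: "'i \<Rightarrow> 'a::euclidean_space"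
  assumes "finite I" "\<And>i. i \<in> I \<Longrightarrow> w i \<noteq> 0"
  shows "\<exists>u. \<forall>i\<in>I. w i \<bullet> u \<noteq> 0"
proof (rule ccontr)
  assume "\<not> ?thesis"
  then have "(UNIV :: 'a set) = (\<Union>i\<in>I. {u. w i \<bullet> u = 0})" by auto
  moreover have "negligible (\<Union>i\<in>I. {u. w i \<bullet> u = 0})"
    using assms by (intro negligible_Union) (auto intro!: negligible_hyperplane)
  ultimately show False
    using non_negligible_UNIV by metis
qed

text \<open>Along a line in a direction orthogonal to none of the \<open>w i\<close>, the question
  becomes one-dimensional.\<close>

lemma exists_vector_far_from_integers:
  fixes w :: "'i \<Rightarrow> 'a::euclidean_space" and c :: "'i \<Rightarrow> real" and \<eta> :: real
  assumes "finite I" "\<And>i. i \<in> I \<Longrightarrow> w i \<noteq> 0" "\<eta> > 0" "8 * card I * \<eta> \<le> 1"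
  shows "\<exists>x. \<forall>i\<in>I. \<forall>n::int. \<eta> < \<bar>w i \<bullet> x - c i - of_int n\<bar>"
proof -
  obtain u where "\<forall>i\<in>I. w i \<bullet> u \<noteq> 0"
    using exists_vector_not_orthogonal[of I w] assms by blast
  then obtain s where "\<forall>i\<in>I. \<forall>n::int. \<eta> < \<bar>w i \<bullet> u * s - c i - of_int n\<bar>"
    using exists_multiple_far_from_integers[of I "\<lambda>i. w i \<bullet> u" \<eta> c] assms by blast
  then show ?thesis by (intro exI[of _ "s *\<^sub>R u"]) (simp add: mult.commute)
qed

section \<open>Cut-and-project sets and the missed convex set\<close>

lemma cut_and_project_near_integers:
  fixes S :: "(real^'d) set"
  assumes "cut_and_project_set S" "\<eta> > 0"
  shows "\<exists>G. short_vectors G \<and> 0 \<notin> G \<and>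
    (\<forall>w\<in>G. \<exists>c. \<forall>x\<in>S. \<exists>n::int. \<bar>w \<bullet> x - c - of_int n\<bar> \<le> \<eta>)"
proof -
  obtain k L v W M where L: "lattice_in (UNIV \<times> Rint k) L"
    and W: "\<And>y. y \<in> W \<Longrightarrow> L2_set y {..<k} \<le> M" and S: "S = cut_and_project ((\<lambda>p. v + p) ` L) W"
    using assms(1) unfolding cut_and_project_set_def grid_in_def bounded_window_def by blast
  \<comment> \<open>The internal part contributes at most \<open>k\<close> products, each at most
    \<open>\<delta> * \<bar>M\<bar>\<close>. The absolute value covers a negative \<open>M\<close>,
    possible for an empty window; the \<open>+ 1\<close> keeps the denominator positive.\<close>
  define \<delta> where "\<delta> = \<eta> / (real k * \<bar>M\<bar> + 1)"
  have den: "real k * \<bar>M\<bar> + 1 > 0" by (simp add: add_nonneg_pos)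
  have \<delta>: "\<delta> > 0" "real k * (\<delta> * \<bar>M\<bar>) \<le> \<eta>"
    using assms(2) den by (auto simp: \<delta>_def field_simps)
  define G where
    "G = {w. w \<noteq> 0 \<and> (\<exists>y. (\<forall>j<k. \<bar>y j\<bar> \<le> \<delta>) \<and> (w, y) \<in> dual_lattice k L)}"
  have "\<exists>c. \<forall>x\<in>S. \<exists>n::int. \<bar>w \<bullet> x - c - of_int n\<bar> \<le> \<eta>" if "w \<in> G" for w
  proof -
    obtain y where y: "\<And>j. j < k \<Longrightarrow> \<bar>y j\<bar> \<le> \<delta>" "(w, y) \<in> dual_lattice k L"
      using \<open>w \<in> G\<close> unfolding G_def by blast
    \<comment> \<open>The constant \<open>c\<close> is the pairing with the translation vector
      \<open>v\<close> of the grid; the remaining discrepancy is the internal part of the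
      pairing.\<close>
    have "\<exists>n::int. \<bar>w \<bullet> x - pairing k (w, y) v - of_int n\<bar> \<le> \<eta>" if "x \<in> S" for x
    proof -
      obtain l where l: "l \<in> L" "x = fst (v + l)" "snd (v + l) \<in> W"
        using \<open>x \<in> S\<close> unfolding S cut_and_project_def by blast
      define z where "z = snd (v + l)"
      obtain n :: int where n: "pairing k (w, y) l = of_int n"
        using y(2) l(1) by (auto simp: dual_lattice_def elim: Ints_cases)
      have "pairing k (w, y) v + of_int n = w \<bullet> x + (\<Sum>j<k. y j * z j)"
        unfolding n[symmetric] pairing_add_right[symmetric] by (simp add: pairing_def l(2) z_def)
      then have "\<bar>w \<bullet> x - pairing k (w, y) v - of_int n\<bar> = \<bar>\<Sum>j<k. y j * z j\<bar>"
        by linarith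
      also have "\<dots> \<le> (\<Sum>j<k. \<bar>y j * z j\<bar>)" by (rule sum_abs)
      also have "\<dots> \<le> (\<Sum>j<k. \<delta> * \<bar>M\<bar>)"
        unfolding abs_mult
      proof (rule sum_mono)
        fix j assume j: "j \<in> {..<k}"
        have "\<bar>z j\<bar> \<le> L2_set (\<lambda>j. \<bar>z j\<bar>) {..<k}"
          using j by (intro member_le_L2_set) auto
        also have "\<dots> = L2_set z {..<k}" by (simp add: L2_set_def)
        also have "\<dots> \<le> \<bar>M\<bar>" using W[of z] l(3) by (simp add: z_def)
        finally show "\<bar>y j\<bar> * \<bar>z j\<bar> \<le> \<delta> * \<bar>M\<bar>"
          using y(1)[of j] j \<delta>(1) by (intro mult_mono) auto
      qed
      also have "\<dots> \<le> \<eta>" using \<delta>(2) by simp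
      finally show ?thesis by blast
    qed
    then show ?thesis by blast
  qed
  moreover have "short_vectors G"
    unfolding G_def by (rule dual_lattice_short_vectors[OF L \<delta>(1)])
  moreover have "0 \<notin> G" by (simp add: G_def)
  ultimately show ?thesis by blast
qed

theorem theorem1p2:
  fixes \<Lambda> :: "(real ^ 'd) set" and F :: "(real ^ 'd) set set"
  assumes "CARD('d) > 1"
    and "finite F"
    and "\<forall>S\<in>F. cut_and_project_set S"
    and "\<Lambda> = \<Union>F"
  shows "\<not> danzer \<Lambda>"
proof
  assume danzer: "danzer \<Lambda>"
  \<comment> \<open>Half of \<eta> is spent on the distance of \<open>w \<bullet> x\<close> from a
    translate of the integers, half on its variation over \<open>K\<close>. The \<open>+ 1\<close>
    covers an empty \<open>F\<close>.\<close>
  define \<eta> where "\<eta> = 1 / (8 * (real (card F) + 1))"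
  have \<eta>: "\<eta> > 0" "8 * card F * \<eta> \<le> 1" by (auto simp: \<eta>_def field_simps)
  have "\<forall>S\<in>F. \<exists>G. short_vectors G \<and> 0 \<notin> G \<and>
      (\<forall>w\<in>G. \<exists>c. \<forall>x\<in>S. \<exists>n::int. \<bar>w \<bullet> x - c - of_int n\<bar> \<le> \<eta> / 2)"
    using assms(3) \<eta>(1) by (intro ballI cut_and_project_near_integers) auto
  from bchoice[OF this] obtain G where G: "\<And>S. S \<in> F \<Longrightarrow> short_vectors (G S)"
    "\<And>S. S \<in> F \<Longrightarrow> 0 \<notin> G S"
    "\<And>S w. S \<in> F \<Longrightarrow> w \<in> G S \<Longrightarrow>
      \<exists>c. \<forall>x\<in>S. \<exists>n::int. \<bar>w \<bullet> x - c - of_int n\<bar> \<le> \<eta> / 2"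
    by blast
  obtain r where r: "r > 0" "\<And>q::real^'d. q \<in> cbox 0 One \<Longrightarrow> norm q \<le> r"
    using bounded_cbox unfolding bounded_pos by blast
  obtain R where R: "\<forall>g g'. unimodular_pair g g' \<longrightarrow>
      (\<exists>h h'. unimodular_pair h h' \<and> (\<forall>x::real^'d. norm (h x) \<le> R * norm x) \<and>
        (\<forall>S\<in>F. \<exists>w\<in>G S. norm (h (g w)) \<le> \<eta> / (2 * r)))"
    using simultaneous_short_vectors[where G = G, OF assms(1,2) G(1), of "\<eta> / (2 * r)"] \<eta>(1) r(1)
    by auto
  \<comment> \<open>The identity serves as \<open>g\<close>; the generality in \<open>g\<close> was
    for the induction.\<close>
  obtain h h' where h: "unimodular_pair h h'"
    and short: "\<forall>S\<in>F. \<exists>w\<in>G S. norm (h w) \<le> \<eta> / (2 * r)"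
    using R[rule_format, OF unimodular_pair_id] by blast
  have lin: "linear h'" and adj: "\<And>x y. h x \<bullet> y = x \<bullet> h' y" and vol: "volume_preserving h'"
    using h by (auto simp: unimodular_pair_def)
  obtain w where w: "\<And>S. S \<in> F \<Longrightarrow> w S \<in> G S" "\<And>S. S \<in> F \<Longrightarrow> norm (h (w S)) \<le> \<eta> / (2 * r)"
    using bchoice[OF short[unfolded Bex_def]] by blast
  have "\<forall>S\<in>F. \<exists>c. \<forall>x\<in>S. \<exists>n::int. \<bar>w S \<bullet> x - c - of_int n\<bar> \<le> \<eta> / 2"
    using G(3) w(1) by blast
  from bchoice[OF this] obtain c where
    c: "\<And>S x. S \<in> F \<Longrightarrow> x \<in> S \<Longrightarrow> \<exists>n::int. \<bar>w S \<bullet> x - c S - of_int n\<bar> \<le> \<eta> / 2"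
    by blast
  have "w S \<noteq> 0" if "S \<in> F" for S
    using G(2) w(1) that by metis
  then obtain x0 where
    x0: "\<And>S n. S \<in> F \<Longrightarrow> \<eta> < \<bar>w S \<bullet> x0 - c S - of_int n\<bar>"
    using exists_vector_far_from_integers[OF assms(2) _ \<eta>, of w c] by blast
  \<comment> \<open>By adjointness, \<open>w S\<close> varies over \<open>K\<close> as
    \<open>h (w S)\<close> varies over the unit cube, that is by at most
    \<open>\<eta> / (2 * r) * r\<close>.\<close>
  define K where "K = (+) x0 ` h' ` cbox 0 One"
  have "convex K"
    unfolding K_def by (intro convex_translation convex_linear_image lin convex_box)
  moreover have "emeasure lebesgue K = 1"
  proof -
    have "K \<in> lmeasurable" "measure lebesgue K = 1"
      using vol by (simp_all add: K_def volume_preserving_def measurable_translation measure_translation)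
    then show ?thesis by (simp add: emeasure_eq_measure2)
  qed
  ultimately obtain x S where x: "x \<in> K" "x \<in> S" "S \<in> F"
    using danzer assms(4) unfolding danzer_def by blast
  obtain q where q: "q \<in> cbox 0 One" "x = x0 + h' q" using x(1) by (auto simp: K_def)
  obtain n :: int where n: "\<bar>w S \<bullet> x - c S - of_int n\<bar> \<le> \<eta> / 2"
    using c x by blast
  have "\<bar>h (w S) \<bullet> q\<bar> \<le> norm (h (w S)) * norm q" by (rule Cauchy_Schwarz_ineq2)
  also have "\<dots> \<le> \<eta> / (2 * r) * r"
    using w(2)[OF x(3)] r q(1) \<eta>(1) by (intro mult_mono) auto
  also have "\<dots> = \<eta> / 2" using r(1) by simp
  finally have "\<bar>w S \<bullet> x - w S \<bullet> x0\<bar> \<le> \<eta> / 2"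
    by (simp add: q(2) inner_add_right adj)
  with n x0[OF x(3), of n] show False by linarith
qed

end
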